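(* Let $n\ge 2$ be an integer and let $\mathrm{BS}(1,n)=\langle a,b \mid b^{-1}ab=a^n\rangle$ act on $\mathbb{R}$ by affine maps via $a(x)=x+1$ and $b(x)=x/n$. Then the orbit equivalence relation $E$ on $\mathbb{R}$ generated by this action (i.e. $x\mathrel{E}y$ if and only if there is $g\in \mathrm{BS}(1,n)$ with $g(x)=y$) is hyperfinite.
   Context: A Borel equivalence relation on a Polish (or standard Borel) space is hyperfinite if it is an increasing union of countably many Borel equivalence relations each having only finite classes. *)

theory Defs
  imports "HOL-Analysis.Analysis" "HOL-Algebra.Group_Action"
begin

section \<open>Hyperfinite Borel equivalence relations\<close>

definition borel_equiv :: "('a::polish_space \<times> 'a) set \<Rightarrow> bool" where
  "borel_equiv E \<longleftrightarrow> equiv UNIV E \<and> E \<in> sets borel"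

definition hyperfinite :: "('a::polish_space \<times> 'a) set \<Rightarrow> bool" where
  "hyperfinite E \<longleftrightarrow> borel_equiv E \<and>
     (\<exists>F :: nat \<Rightarrow> ('a \<times> 'a) set.
        incseq F \<and>
        (\<forall>k. borel_equiv (F k) \<and> (\<forall>x. finite (F k `` {x}))) \<and>
        E = (\<Union>k. F k))"


section \<open>Group presentations\<close>

datatype 'g letter = Gen 'g | Inv 'g

primrec flip :: "'g letter \<Rightarrow> 'g letter" where
  "flip (Gen x) = Inv x"
| "flip (Inv x) = Gen x"

lemma flip_flip [simp]: "flip (flip l) = l"
  by (cases l) auto

type_synonym 'g word = "'g letter list"

text \<open>A pair \<open>(l, r)\<close> in \<open>R\<close> stands for the defining relation \<open>l = r\<close>.\<close>

inductive pres_eq :: "('g word \<times> 'g word) set \<Rightarrow> 'g word \<Rightarrow> 'g word \<Rightarrow> bool"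
  for R :: "('g word \<times> 'g word) set" where
  refl: "pres_eq R u u"
| sym: "pres_eq R u v \<Longrightarrow> pres_eq R v u"
| trans: "pres_eq R u v \<Longrightarrow> pres_eq R v w \<Longrightarrow> pres_eq R u w"
| cancel: "pres_eq R (u @ [l, flip l] @ v) (u @ v)"
| relation: "(l, r) \<in> R \<Longrightarrow> pres_eq R (u @ l @ v) (u @ r @ v)"

definition pres_class :: "('g word \<times> 'g word) set \<Rightarrow> 'g word \<Rightarrow> 'g word set" where
  "pres_class R w = {v. pres_eq R w v}"

definition presented_group :: "('g word \<times> 'g word) set \<Rightarrow> 'g word set monoid" where
  "presented_group R =
     \<lparr>carrier = range (pres_class R),
      mult = (\<lambda>X Y. \<Union>u\<in>X. \<Union>v\<in>Y. pres_class R (u @ v)),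
      one = pres_class R []\<rparr>"

lemma pres_class_eq_iff: "pres_class R u = pres_class R v \<longleftrightarrow> pres_eq R u v"
  unfolding pres_class_def set_eq_iff mem_Collect_eq
  by (meson pres_eq.refl pres_eq.sym pres_eq.trans)

lemma pres_eq_context: "pres_eq R u v \<Longrightarrow> pres_eq R (p @ u @ s) (p @ v @ s)"
proof (induction rule: pres_eq.induct)
  case (cancel u l v)
  show ?case using pres_eq.cancel[of R "p @ u" l "v @ s"] by simp
next
  case (relation l r u v)
  then show ?case using pres_eq.relation[of l r R "p @ u" "v @ s"] by simp
qed (auto intro: pres_eq.intros)

lemma pres_eq_append:
  assumes "pres_eq R u u'" "pres_eq R v v'"
  shows "pres_eq R (u @ v) (u' @ v')"
  using pres_eq.trans[OF pres_eq_context[OF assms(1), of "[]" v, simplified]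
      pres_eq_context[OF assms(2), of u' "[]", simplified]]
  by simp

lemma mult_pres_class:
  "pres_class R u \<otimes>\<^bsub>presented_group R\<^esub> pres_class R v = pres_class R (u @ v)"
proof -
  have "pres_class R (u' @ v') = pres_class R (u @ v)"
    if "u' \<in> pres_class R u" "v' \<in> pres_class R v" for u' v'
    using that unfolding pres_class_eq_iff unfolding pres_class_def mem_Collect_eq
    by (intro pres_eq.sym[OF pres_eq_append]) simp_all
  moreover have "u \<in> pres_class R u" "v \<in> pres_class R v"
    by (auto simp: pres_class_def intro: pres_eq.refl)
  ultimately have "(\<Union>u'\<in>pres_class R u. \<Union>v'\<in>pres_class R v. pres_class R (u' @ v'))
      = pres_class R (u @ v)"
    by blast
  then show ?thesis by (simp only: presented_group_def monoid.simps)
qed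

lemma pres_eq_inverse: "pres_eq R (rev (map flip w) @ w) []"
proof (induction w)
  case Nil
  show ?case by (simp add: pres_eq.refl)
next
  case (Cons l w)
  have "pres_eq R (rev (map flip w) @ [flip l, flip (flip l)] @ w) (rev (map flip w) @ w)"
    by (rule pres_eq.cancel)
  then show ?case using Cons by (simp add: pres_eq.trans[OF _ Cons.IH])
qed

lemma group_presented_group: "group (presented_group R)"
proof (rule groupI)
  show "\<one>\<^bsub>presented_group R\<^esub> \<in> carrier (presented_group R)"
    by (simp add: presented_group_def)
next
  fix X Y assume "X \<in> carrier (presented_group R)" "Y \<in> carrier (presented_group R)"
  then obtain u v where "X = pres_class R u" "Y = pres_class R v"
    by (auto simp: presented_group_def)
  then show "X \<otimes>\<^bsub>presented_group R\<^esub> Y \<in> carrier (presented_group R)"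
    by (simp add: mult_pres_class) (simp add: presented_group_def)
next
  fix X Y Z
  assume "X \<in> carrier (presented_group R)" "Y \<in> carrier (presented_group R)"
    "Z \<in> carrier (presented_group R)"
  then obtain u v w where "X = pres_class R u" "Y = pres_class R v" "Z = pres_class R w"
    by (auto simp: presented_group_def)
  then show "X \<otimes>\<^bsub>presented_group R\<^esub> Y \<otimes>\<^bsub>presented_group R\<^esub> Z
      = X \<otimes>\<^bsub>presented_group R\<^esub> (Y \<otimes>\<^bsub>presented_group R\<^esub> Z)"
    by (simp add: mult_pres_class)
next
  fix X assume "X \<in> carrier (presented_group R)"
  then obtain u where u: "X = pres_class R u"
    by (auto simp: presented_group_def)
  have one: "\<one>\<^bsub>presented_group R\<^esub> = pres_class R []"
    by (simp add: presented_group_def)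
  show "\<one>\<^bsub>presented_group R\<^esub> \<otimes>\<^bsub>presented_group R\<^esub> X = X"
    by (simp add: one u mult_pres_class)
  have "pres_class R (rev (map flip u)) \<otimes>\<^bsub>presented_group R\<^esub> X = \<one>\<^bsub>presented_group R\<^esub>"
    by (simp add: one u mult_pres_class pres_class_eq_iff pres_eq_inverse)
  then show "\<exists>Y\<in>carrier (presented_group R). Y \<otimes>\<^bsub>presented_group R\<^esub> X = \<one>\<^bsub>presented_group R\<^esub>"
    by (auto simp: presented_group_def)
qed

context group
begin

fun word_value :: "('g \<Rightarrow> 'a) \<Rightarrow> 'g word \<Rightarrow> 'a" where
  "word_value f [] = \<one>"
| "word_value f (Gen x # w) = f x \<otimes> word_value f w"
| "word_value f (Inv x # w) = inv (f x) \<otimes> word_value f w"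

lemma word_value_closed [simp]:
  assumes "\<And>x. f x \<in> carrier G"
  shows "word_value f w \<in> carrier G"
  using assms by (induction f w rule: word_value.induct) auto

lemma word_value_append:
  assumes "\<And>x. f x \<in> carrier G"
  shows "word_value f (u @ v) = word_value f u \<otimes> word_value f v"
  using assms by (induction f u rule: word_value.induct) (auto simp: m_assoc)

lemma word_value_pres_eq:
  assumes f: "\<And>x. f x \<in> carrier G"
    and R: "\<And>l r. (l, r) \<in> R \<Longrightarrow> word_value f l = word_value f r"
    and "pres_eq R u v"
  shows "word_value f u = word_value f v"
  using assms(3)
proof (induction rule: pres_eq.induct)
  case (cancel u l v)
  have "word_value f [l, flip l] = \<one>"
    using f by (cases l) auto
  then have "word_value f ([l, flip l] @ v) = word_value f v"
    using f by (simp only: word_value_append l_one word_value_closed)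
  then show ?case using f by (simp only: word_value_append)
next
  case (relation l r u v)
  then show ?case using f R by (simp only: word_value_append)
qed auto

text \<open>The universal property of the presented group.\<close>

lemma presented_group_hom:
  assumes f: "\<And>x. f x \<in> carrier G"
    and R: "\<And>l r. (l, r) \<in> R \<Longrightarrow> word_value f l = word_value f r"
  obtains h where "group_hom (presented_group R) G h"
    and "\<And>x. h (pres_class R [Gen x]) = f x"
proof -
  define h where "h X = word_value f (SOME w. w \<in> X)" for X
  have h: "h (pres_class R w) = word_value f w" for w
  proof -
    have "(SOME v. v \<in> pres_class R w) \<in> pres_class R w"
      by (rule someI[of _ w]) (simp add: pres_class_def pres_eq.refl)
    then have "pres_eq R w (SOME v. v \<in> pres_class R w)"
      by (simp add: pres_class_def)
    then show ?thesis
      using word_value_pres_eq[OF f R] by (auto simp: h_def)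
  qed
  have "h \<in> hom (presented_group R) G"
  proof (rule homI)
    fix X assume "X \<in> carrier (presented_group R)"
    then show "h X \<in> carrier G"
      using f by (auto simp: presented_group_def h)
  next
    fix X Y assume "X \<in> carrier (presented_group R)" "Y \<in> carrier (presented_group R)"
    then obtain u v where "X = pres_class R u" "Y = pres_class R v"
      by (auto simp: presented_group_def)
    then show "h (X \<otimes>\<^bsub>presented_group R\<^esub> Y) = h X \<otimes> h Y"
      using f by (simp add: mult_pres_class h word_value_append)
  qed
  then have "group_hom (presented_group R) G h"
    by (simp add: group_hom_def group_hom_axioms_def group_presented_group is_group)
  moreover have "h (pres_class R [Gen x]) = f x" for x
    using f by (simp add: h)
  ultimately show ?thesis using that by blast
qed

end


section \<open>The Baumslag--Solitar groups \<open>BS(1,n)\<close>\<close>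

datatype bs_gen = gen_a | gen_b

definition BS1_relations :: "nat \<Rightarrow> (bs_gen word \<times> bs_gen word) set" where
  "BS1_relations n = {([Inv gen_b, Gen gen_a, Gen gen_b], replicate n (Gen gen_a))}"

definition BS1 :: "nat \<Rightarrow> bs_gen word set monoid" where
  "BS1 n = presented_group (BS1_relations n)"

definition BS1_a :: "nat \<Rightarrow> bs_gen word set" where
  "BS1_a n = pres_class (BS1_relations n) [Gen gen_a]"

definition BS1_b :: "nat \<Rightarrow> bs_gen word set" where
  "BS1_b n = pres_class (BS1_relations n) [Gen gen_b]"

definition BS1_affine_action :: "nat \<Rightarrow> (bs_gen word set \<Rightarrow> real \<Rightarrow> real) \<Rightarrow> bool" where
  "BS1_affine_action n \<phi> \<longleftrightarrow>
     group_action (BS1 n) (UNIV :: real set) \<phi> \<and>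
     \<phi> (BS1_a n) = (\<lambda>x. x + 1) \<and>
     \<phi> (BS1_b n) = (\<lambda>x. x / real n)"

definition orbit_equiv :: "('a, 'm) monoid_scheme \<Rightarrow> ('a \<Rightarrow> 'b \<Rightarrow> 'b) \<Rightarrow> ('b \<times> 'b) set" where
  "orbit_equiv G \<phi> = {(x, y). \<exists>g\<in>carrier G. \<phi> g x = y}"

text \<open>The prescribed values on the generators do extend to an action.\<close>

lemma BS1_affine_action_exists:
  assumes "n \<ge> 1"
  shows "\<exists>\<phi>. BS1_affine_action n \<phi>"
proof -
  interpret P: group "BijGroup (UNIV :: real set)"
    by (rule group_BijGroup)
  define f :: "bs_gen \<Rightarrow> real \<Rightarrow> real" where
    "f g = (case g of gen_a \<Rightarrow> (\<lambda>x. x + 1) | gen_b \<Rightarrow> (\<lambda>x. x / real n))" for g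
  have carrierI: "h \<in> carrier (BijGroup (UNIV :: real set))" if "bij h" for h :: "real \<Rightarrow> real"
    using that by (simp add: BijGroup_def Bij_def extensional_def)
  have multE: "g \<otimes>\<^bsub>BijGroup (UNIV :: real set)\<^esub> h = (\<lambda>x. g (h x))"
    if "bij g" "bij h" for g h :: "real \<Rightarrow> real"
    using that by (simp add: BijGroup_def Bij_def extensional_def compose_def restrict_def)
  have bijA: "bij (\<lambda>x::real. x + c)" for c
    by (rule bij_betw_byWitness[where f' = "\<lambda>x. x - c"]) auto
  have bijB: "bij (\<lambda>x::real. x / real n)" and bijB': "bij (\<lambda>x::real. x * real n)"
    using assms bij_betw_byWitness[of UNIV "\<lambda>x. x * real n" "\<lambda>x. x / real n" UNIV]
      bij_betw_byWitness[of UNIV "\<lambda>x. x / real n" "\<lambda>x. x * real n" UNIV]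
    by simp_all
  have f: "f g \<in> carrier (BijGroup UNIV)" for g
    by (cases g) (auto simp: f_def intro!: carrierI bijA bijB)
  have one: "\<one>\<^bsub>BijGroup (UNIV :: real set)\<^esub> = (\<lambda>x. x)"
    by (simp add: BijGroup_def restrict_def)
  have inv: "inv\<^bsub>BijGroup UNIV\<^esub> (f gen_b) = (\<lambda>x. x * real n)"
    by (rule P.inv_equality)
      (use assms in \<open>auto simp: f_def one multE bijB bijB' intro!: carrierI\<close>)
  have pow: "P.word_value f (replicate k (Gen gen_a)) = (\<lambda>x. x + real k)" for k
  proof (induction k)
    case 0
    show ?case by (simp add: one)
  next
    case (Suc k)
    have "P.word_value f (replicate (Suc k) (Gen gen_a))
        = (\<lambda>x. x + 1) \<otimes>\<^bsub>BijGroup UNIV\<^esub> (\<lambda>x. x + real k)"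
      by (simp add: Suc) (simp add: f_def)
    also have "\<dots> = (\<lambda>x. x + real (Suc k))"
      by (simp add: multE bijA add_ac)
    finally show ?case .
  qed
  have "P.word_value f [Inv gen_b, Gen gen_a, Gen gen_b]
      = (\<lambda>x. x * real n) \<otimes>\<^bsub>BijGroup UNIV\<^esub>
        ((\<lambda>x. x + 1) \<otimes>\<^bsub>BijGroup UNIV\<^esub> (\<lambda>x. x / real n))"
    using f[of gen_b] by (simp add: inv) (simp add: f_def)
  also have "\<dots> = (\<lambda>x. x * real n) \<otimes>\<^bsub>BijGroup UNIV\<^esub> (\<lambda>x. x / real n + 1)"
    by (simp add: multE bijA bijB)
  also have "\<dots> = (\<lambda>x. (x / real n + 1) * real n)"
    using bij_comp[OF bijB bijA[of 1]] by (simp add: multE bijB' comp_def)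
  also have "\<dots> = (\<lambda>x. x + real n)"
    using assms by (simp add: distrib_right)
  finally have rel: "P.word_value f [Inv gen_b, Gen gen_a, Gen gen_b] = P.word_value f (replicate n (Gen gen_a))"
    by (simp only: pow)
  obtain h where "group_hom (BS1 n) (BijGroup UNIV) h"
    and "\<And>g. h (pres_class (BS1_relations n) [Gen g]) = f g"
  proof (rule P.presented_group_hom[of f "BS1_relations n"])
    show "P.word_value f l = P.word_value f r" if "(l, r) \<in> BS1_relations n" for l r
      using that rel unfolding BS1_relations_def by (simp only: singleton_iff prod.inject)
  qed (simp_all only: f BS1_def)
  then have "BS1_affine_action n h"
    by (simp add: BS1_affine_action_def group_action_def BS1_a_def BS1_b_def f_def)
  then show ?thesis by blast
qed

end

theory Submission
  imports Defs
begin

text \<open>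
  Two reals \<open>x\<close>, \<open>y\<close> lie in the same orbit iff \<open>n\<^sup>i x - n\<^sup>j y\<close> is an integer for some
  \<open>i, j\<close>, that is, iff the forward orbits of \<open>x\<close> and \<open>y\<close> under \<open>f x = frac (n x)\<close> meet
  (\<open>orbit_equiv_BS1\<close>). The problem thus becomes the hyperfiniteness of the tail equivalence of
  a Borel map \<open>f\<close> with bounded range and locally finite fibres (\<open>hyperfinite_tail_equiv\<close>).

  The idea, going back to Dougherty, Jackson and Kechris, is to pick points further and further out
  on a forward orbit in a way that does not depend on where the orbit is entered. Let \<open>z x\<close> be
  the limit inferior of the orbit of \<open>x\<close>. It depends only on the class of \<open>x\<close>, and the orbit comes
  arbitrarily close to it. Let \<open>g\<^sub>m x\<close> be the first point of the orbit at distance less than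
  \<open>1 / (m + 1)\<close> from \<open>z x\<close>. If \<open>z x\<close> is not on the orbit, the time of this visit tends to
  infinity with \<open>m\<close>. So for equivalent \<open>x\<close>, \<open>y\<close> it is eventually later than the time at which
  the two orbits merge, and then \<open>g\<^sub>m x = g\<^sub>m y\<close>. On the classes that contain their own limit
  inferior, the constant choice \<open>g\<^sub>m x = z x\<close> serves instead.

  In this way the relation is an increasing union of the kernels of the maps \<open>g\<^sub>m\<close>. Their classes
  are countable, not finite. However, a point \<open>x\<close> of a bounded set is determined, up to finitely many possibilities, by
  \<open>g\<^sub>m x\<close> and the waiting times between successive visits. Putting a bound \<open>k\<close> on these times
  for the steps before the merging, as one does for eventual equality of sequences of naturals,
  gives finite equivalence relations (\<open>hyperfinite_union_kernels\<close>).
\<close>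

section \<open>Increasing unions of smooth relations\<close>

text \<open>
  The number \<open>c (Suc m) x\<close> records how \<open>g m x\<close> sits above \<open>g (Suc m) x\<close>, and \<open>c 0 x\<close> how \<open>x\<close> sits
  above \<open>g 0 x\<close>. The model case is eventual equality of sequences of naturals, which is the
  union over \<open>k\<close> of the relations ``equal from some position \<open>m \<le> k\<close> on, with all earlier entries
  at most \<open>k\<close>''. These relations are transitive: when two merging positions \<open>m \<le> m'\<close> occur,
  the entries between them are shared with the middle sequence, hence bounded by \<open>k\<close> as well.
\<close>

lemma hyperfinite_union_kernels:
  fixes g :: "nat \<Rightarrow> 'a::polish_space \<Rightarrow> 'b::{second_countable_topology, linorder_topology}"
    and c :: "nat \<Rightarrow> 'a \<Rightarrow> nat"
  assumes g [measurable]: "\<And>m. g m \<in> borel_measurable borel"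
    and c [measurable]: "\<And>m. c m \<in> measurable borel (count_space UNIV)"
    and step_g: "\<And>m x y. g m x = g m y \<Longrightarrow> g (Suc m) x = g (Suc m) y"
    and step_c: "\<And>m x y. g m x = g m y \<Longrightarrow> c (Suc m) x = c (Suc m) y"
    and fin: "\<And>m k u. finite {y. g m y = u \<and> (\<forall>i\<le>m. c i y \<le> k)}"
  shows "hyperfinite {(x, y). \<exists>m. g m x = g m y}"
proof -
  define F where "F k = {(x, y). x = y \<or> (\<exists>m\<le>k. g m x = g m y \<and>
      (\<forall>i\<le>m. c i x \<le> k) \<and> (\<forall>i\<le>m. c i y \<le> k))}" for k
  define E where "E = {(x, y). \<exists>m. g m x = g m y}"
  have later_g: "g m' x = g m' y" if "m \<le> m'" "g m x = g m y" for m m' x y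
    using that by (induction m' rule: dec_induct) (auto intro: step_g)
  have later_c: "c i x = c i y" if "m < i" "g m x = g m y" for m i x y
    using step_c[OF later_g[of m "i - 1" x y]] that by auto
  have F_sub: "F k \<subseteq> E" for k
    by (auto simp: F_def E_def)
  have incseq: "incseq F"
  proof (rule incseq_SucI)
    fix k show "F k \<subseteq> F (Suc k)"
      unfolding F_def by (auto intro: le_SucI)
  qed
  have union: "E = (\<Union>k. F k)"
  proof (intro equalityI subsetI)
    fix p assume "p \<in> E"
    then obtain x y m where p: "p = (x, y)" and m: "g m x = g m y"
      by (auto simp: E_def)
    define k where "k = m + (\<Sum>i\<le>m. c i x) + (\<Sum>i\<le>m. c i y)"
    have "c i x \<le> k \<and> c i y \<le> k" if "i \<le> m" for i
      using member_le_sum[of i "{..m}" "\<lambda>i. c i x"] member_le_sum[of i "{..m}" "\<lambda>i. c i y"] that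
      by (simp add: k_def)
    moreover have "m \<le> k" by (simp add: k_def)
    ultimately have "p \<in> F k" using m unfolding p F_def by blast
    then show "p \<in> (\<Union>k. F k)" by blast
  qed (use F_sub in blast)
  have trans_aux: "(x, z) \<in> F k" "(z, x) \<in> F k"
    if "m \<le> m'" "m' \<le> k" "g m x = g m y" "g m' y = g m' z"
      "\<forall>i\<le>m. c i x \<le> k" "\<forall>i\<le>m'. c i y \<le> k" "\<forall>i\<le>m'. c i z \<le> k" for m m' k x y z
  proof -
    have "c i x \<le> k" if "i \<le> m'" for i
      using that \<open>\<forall>i\<le>m. c i x \<le> k\<close> \<open>\<forall>i\<le>m'. c i y \<le> k\<close> later_c[of m i x y] \<open>g m x = g m y\<close>
      by (cases "i \<le> m") auto
    moreover have "g m' x = g m' z"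
      using later_g[of m m' x y] that by simp
    ultimately show "(x, z) \<in> F k" "(z, x) \<in> F k"
      using that(2,7) unfolding F_def by auto
  qed
  have sym: "sym (F k)" for k
    by (rule symI) (auto simp: F_def intro: sym)
  have trans: "trans (F k)" for k
  proof (rule transI)
    fix x y z assume xy: "(x, y) \<in> F k" and yz: "(y, z) \<in> F k"
    show "(x, z) \<in> F k"
    proof (cases "x = y \<or> y = z")
      case False
      then obtain m m' where *:
        "m \<le> k" "g m x = g m y" "\<forall>i\<le>m. c i x \<le> k" "\<forall>i\<le>m. c i y \<le> k"
        "m' \<le> k" "g m' y = g m' z" "\<forall>i\<le>m'. c i y \<le> k" "\<forall>i\<le>m'. c i z \<le> k"
        using xy yz by (auto simp: F_def)
      show ?thesis
      proof (cases "m \<le> m'")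
        case True
        then show ?thesis by (rule trans_aux(1)) (fact *)+
      next
        case False
        then have "m' \<le> m" by simp
        then show ?thesis by (rule trans_aux(2)) (fact * *(2)[symmetric] *(6)[symmetric])+
      qed
    qed (use xy yz in auto)
  qed
  have equiv_F: "equiv UNIV (F k)" for k
    by (rule equivI) (auto simp: sym trans, auto simp: refl_on_def F_def)
  have equiv_E: "equiv UNIV E"
  proof (rule equivI)
    show "trans E"
    proof (rule transI)
      fix x y z assume "(x, y) \<in> E" "(y, z) \<in> E"
      then obtain m m' where "g m x = g m y" "g m' y = g m' z" by (auto simp: E_def)
      then have "g (max m m') x = g (max m m') z"
        using later_g[of m "max m m'" x y] later_g[of m' "max m m'" y z] by simp
      then show "(x, z) \<in> E" by (auto simp: E_def)
    qed
  qed (auto simp: E_def refl_on_def sym_def, metis)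
  have eq_meas: "{p :: 'a \<times> 'a. fst p = snd p} \<in> sets borel"
    by (intro borel_closed closed_Collect_eq continuous_intros)
  have borel_F: "F k \<in> sets borel" for k
  proof -
    let ?S = "\<lambda>p :: 'a \<times> 'a. \<exists>m\<in>{..k}. g m (fst p) = g m (snd p) \<and>
      (\<forall>i\<in>{..m}. c i (fst p) \<le> k) \<and> (\<forall>i\<in>{..m}. c i (snd p) \<le> k)"
    have "Measurable.pred (borel \<Otimes>\<^sub>M borel) ?S"
      by measurable
    then have "Collect ?S \<in> sets borel"
      by (simp add: borel_prod pred_def)
    moreover have "F k = {p. fst p = snd p} \<union> Collect ?S"
      unfolding F_def by auto
    ultimately show ?thesis using eq_meas by auto
  qed
  have borel_E: "E \<in> sets borel"
    unfolding union using borel_F by blast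
  have "finite (F k `` {x})" for k x
  proof (rule finite_subset)
    show "F k `` {x} \<subseteq> {x} \<union> (\<Union>m\<le>k. {y. g m y = g m x \<and> (\<forall>i\<le>m. c i y \<le> k)})"
      by (auto simp: F_def)
  qed (use fin in auto)
  then show ?thesis
    unfolding hyperfinite_def borel_equiv_def E_def[symmetric]
    using equiv_E borel_E equiv_F borel_F incseq union by blast
qed


section \<open>Tail equivalence of a bounded Borel map\<close>

definition tail_equiv :: "('a \<Rightarrow> 'a) \<Rightarrow> ('a \<times> 'a) set" where
  "tail_equiv f = {(x, y). \<exists>i j. (f ^^ i) x = (f ^^ j) y}"

lemma tail_equivI: "(f ^^ i) x = (f ^^ j) y \<Longrightarrow> (x, y) \<in> tail_equiv f"
  by (auto simp: tail_equiv_def)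

lemma equiv_tail_equiv: "equiv UNIV (tail_equiv f)"
proof (rule equivI)
  show "trans (tail_equiv f)"
  proof (rule transI)
    fix x y z assume "(x, y) \<in> tail_equiv f" "(y, z) \<in> tail_equiv f"
    then obtain i j k l where 1: "(f ^^ i) x = (f ^^ j) y" and 2: "(f ^^ k) y = (f ^^ l) z"
      by (auto simp: tail_equiv_def)
    have "(f ^^ (k + i)) x = (f ^^ (k + j)) y"
      by (simp add: funpow_add 1)
    also have "\<dots> = (f ^^ (j + l)) z"
      by (simp add: add.commute[of k] funpow_add 2)
    finally show "(x, z) \<in> tail_equiv f" by (rule tail_equivI)
  qed
  show "sym (tail_equiv f)"
    unfolding tail_equiv_def by (auto intro!: symI) (metis)
qed (auto simp: refl_on_def tail_equiv_def)

lemma borel_measurable_funpow: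
  fixes f :: "'a::topological_space \<Rightarrow> 'a"
  assumes "f \<in> borel_measurable borel"
  shows "f ^^ i \<in> borel_measurable borel"
proof (induction i)
  case (Suc i)
  then show ?case using measurable_comp[OF Suc assms] by (simp add: comp_def)
qed (simp add: id_def)

text \<open>
  The fibres of \<open>f\<close> itself may be infinite. Since the range of \<open>f\<close> is bounded, only the last
  of the \<open>i\<close> preimages has to be confined to a bounded set by hand.
\<close>

lemma finite_funpow_fibre:
  fixes f :: "real \<Rightarrow> real"
  assumes bdd: "bounded (range f)"
    and fin: "\<And>r u. finite {x. \<bar>x\<bar> \<le> r \<and> f x = u}"
  shows "finite {x. \<bar>x\<bar> \<le> r \<and> (f ^^ i) x = u}"
proof (induction i arbitrary: r)
  case 0
  show ?case by (rule finite_subset[of _ "{u}"]) auto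
next
  case (Suc i)
  obtain M where M: "\<And>x. \<bar>f x\<bar> \<le> M"
    using bdd by (auto simp: bounded_iff)
  have "finite (\<Union>v\<in>{v. \<bar>v\<bar> \<le> M \<and> (f ^^ i) v = u}. {x. \<bar>x\<bar> \<le> r \<and> f x = v})"
    using Suc fin by auto
  then show ?case
    by (rule rev_finite_subset) (auto simp: M funpow_Suc_right simp del: funpow.simps)
qed

text \<open>
  The limit is taken in the extended reals, where it exists unconditionally and is Borel in \<open>x\<close>.
  For \<open>f\<close> with bounded range it is finite.
\<close>

definition orbit_liminf :: "(real \<Rightarrow> real) \<Rightarrow> real \<Rightarrow> real" where
  "orbit_liminf f x = real_of_ereal (liminf (\<lambda>i. ereal ((f ^^ i) x)))"

lemma borel_measurable_orbit_liminf:
  assumes "f \<in> borel_measurable borel"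
  shows "orbit_liminf f \<in> borel_measurable borel"
proof -
  note borel_measurable_funpow[OF assms, measurable]
  show ?thesis unfolding orbit_liminf_def by measurable
qed

lemma orbit_liminf_funpow: "orbit_liminf f ((f ^^ k) x) = orbit_liminf f x"
  using liminf_shift_k[of "\<lambda>i. ereal ((f ^^ i) x)" k] by (simp add: orbit_liminf_def funpow_add)

lemma orbit_liminf_tail_equiv:
  "(x, y) \<in> tail_equiv f \<Longrightarrow> orbit_liminf f x = orbit_liminf f y"
  unfolding tail_equiv_def using orbit_liminf_funpow[of f] by (auto, metis)

text \<open>
  Some subsequence of the orbit converges to its limit inferior. As shifting the orbit does not
  change the limit inferior, the lemma applied to \<open>(f ^^ k) x\<close> gives arbitrarily late close visits.
\<close>

lemma orbit_liminf_approx: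
  assumes bdd: "bounded (range f)" and "e > 0"
  shows "\<exists>i. \<bar>(f ^^ i) x - orbit_liminf f x\<bar> < e"
proof -
  define u where "u i = ereal ((f ^^ i) x)" for i
  obtain M where M: "\<And>x. \<bar>f x\<bar> \<le> M"
    using bdd by (auto simp: bounded_iff)
  have "\<forall>\<^sub>F i in sequentially. ereal (- M) \<le> u i \<and> u i \<le> ereal M"
    using eventually_gt_at_top[of 0]
  proof eventually_elim
    case (elim i)
    then obtain j where "i = Suc j" by (cases i) auto
    then show ?case using M[of "(f ^^ j) x"] by (simp add: u_def abs_le_iff)
  qed
  then have "ereal (- M) \<le> liminf u" "liminf u \<le> ereal M"
    using Liminf_bounded[of "ereal (- M)" u sequentially] Limsup_bounded[of u "ereal M" sequentially]
      Liminf_le_Limsup[of sequentially u]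
    by (auto simp: eventually_conj_iff intro: order_trans)
  then have fin: "liminf u = ereal (orbit_liminf f x)"
    by (cases "liminf u") (auto simp: orbit_liminf_def u_def[symmetric] cong: if_cong)
  obtain r where "(u \<circ> r) \<longlonglongrightarrow> liminf u"
    using liminf_subseq_lim by blast
  then have "(\<lambda>k. (f ^^ r k) x) \<longlonglongrightarrow> orbit_liminf f x"
    unfolding fin by (simp add: u_def comp_def)
  then have "\<forall>\<^sub>F k in sequentially. dist ((f ^^ r k) x) (orbit_liminf f x) < e"
    using \<open>e > 0\<close> by (rule tendstoD)
  then show ?thesis
    by (auto simp: dist_real_def dest: eventually_happens)
qed

definition first_visit :: "(real \<Rightarrow> real) \<Rightarrow> nat \<Rightarrow> real \<Rightarrow> nat" where
  "first_visit f m x = (LEAST i. \<bar>(f ^^ i) x - orbit_liminf f x\<bar> < 1 / real (Suc m))"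

context
  fixes f :: "real \<Rightarrow> real"
  assumes bdd: "bounded (range f)"
begin

lemma first_visit_close: "\<bar>(f ^^ first_visit f m x) x - orbit_liminf f x\<bar> < 1 / real (Suc m)"
  unfolding first_visit_def by (rule LeastI_ex[OF orbit_liminf_approx[OF bdd]]) simp

lemma first_visit_le: "\<bar>(f ^^ i) x - orbit_liminf f x\<bar> < 1 / real (Suc m) \<Longrightarrow> first_visit f m x \<le> i"
  unfolding first_visit_def by (rule Least_le)

lemma first_visit_mono: "m \<le> m' \<Longrightarrow> first_visit f m x \<le> first_visit f m' x"
  by (rule first_visit_le, rule less_le_trans[OF first_visit_close[of m']]) (simp add: frac_le)

text \<open>
  The point of the first visit is the same for \<open>x\<close> and for any later point of its orbit that has
  not yet passed the visit. This is what makes the choice of the point canonical along an orbit.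
\<close>

lemma first_visit_shift:
  assumes "i \<le> first_visit f m x"
  shows "first_visit f m x = i + first_visit f m ((f ^^ i) x)"
proof (rule antisym)
  show "first_visit f m x \<le> i + first_visit f m ((f ^^ i) x)"
    using first_visit_close[of m "(f ^^ i) x"]
    by (intro first_visit_le) (simp add: orbit_liminf_funpow add.commute[of i] funpow_add)
  have "first_visit f m ((f ^^ i) x) \<le> first_visit f m x - i"
    using first_visit_close[of m x] assms
    by (intro first_visit_le) (simp add: orbit_liminf_funpow flip: funpow_add[THEN fun_cong, simplified])
  then show "i + first_visit f m ((f ^^ i) x) \<le> first_visit f m x"
    using assms by simp
qed

text \<open>
  Each fixed time \<open>j\<close> is excluded once \<open>1 / (m + 1)\<close> drops below the positive distance
  between \<open>(f ^^ j) x\<close> and the limit inferior.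
\<close>

lemma eventually_first_visit_ge:
  assumes "\<And>j. (f ^^ j) x \<noteq> orbit_liminf f x"
  shows "\<forall>\<^sub>F m in sequentially. i \<le> first_visit f m x"
proof -
  have "\<forall>\<^sub>F m in sequentially. first_visit f m x \<noteq> j" for j
  proof -
    have "(\<lambda>m. 1 / real (Suc m)) \<longlonglongrightarrow> 0"
      using LIMSEQ_inverse_real_of_nat by (simp add: inverse_eq_divide)
    moreover have "0 < \<bar>(f ^^ j) x - orbit_liminf f x\<bar>"
      using assms[of j] by simp
    ultimately have "\<forall>\<^sub>F m in sequentially. 1 / real (Suc m) < \<bar>(f ^^ j) x - orbit_liminf f x\<bar>"
      by (rule order_tendstoD)
    then show ?thesis
      by eventually_elim (use first_visit_close[of _ x] in \<open>auto simp: not_less[symmetric] dest: less_asym\<close>)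
  qed
  then have "\<forall>\<^sub>F m in sequentially. \<forall>j\<in>{..<i}. first_visit f m x \<noteq> j"
    by (intro eventually_ball_finite) auto
  then show ?thesis
    by eventually_elim (auto simp: not_less[symmetric])
qed

lemma measurable_first_visit:
  assumes "f \<in> borel_measurable borel"
  shows "first_visit f m \<in> measurable borel (count_space UNIV)"
proof -
  note borel_measurable_funpow[OF assms, measurable] borel_measurable_orbit_liminf[OF assms, measurable]
  show ?thesis unfolding first_visit_def by measurable
qed

theorem hyperfinite_tail_equiv:
  assumes meas: "f \<in> borel_measurable borel"
    and fin: "\<And>r u. finite {x. \<bar>x\<bar> \<le> r \<and> f x = u}"
  shows "hyperfinite (tail_equiv f)"
proof -
  note [measurable] = meas borel_measurable_funpow[OF meas] borel_measurable_orbit_liminf[OF meas]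
    measurable_first_visit[OF meas]
  define z where "z = orbit_liminf f"
  define a where "a = first_visit f"
  define B where "B x \<longleftrightarrow> (x, z x) \<in> tail_equiv f" for x
  \<comment> \<open>Membership in \<open>B\<close> has to be invariant under tail equivalence. That \<open>z x\<close> is on the forward
    orbit of \<open>x\<close> is not: if \<open>x = z x\<close> is not periodic, the condition fails for \<open>f x\<close>.\<close>
  define g where "g m x = (if B x then z x else (f ^^ a m x) x)" for m x
  \<comment> \<open>\<open>P x s\<close> leaves finitely many candidates for \<open>x\<close> once \<open>g 0 x\<close> is known. The bound on \<open>\<bar>x\<bar>\<close> is
    needed because fibres are only locally finite.\<close>
  define P where "P x s \<longleftrightarrow> \<bar>x\<bar> \<le> real s \<and> (if B x then \<exists>i\<le>s. \<exists>j\<le>s. (f ^^ i) x = (f ^^ j) (z x)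
      else a 0 x \<le> s)" for x s
  define c where "c m x = (case m of 0 \<Rightarrow> LEAST s. P x s
      | Suc l \<Rightarrow> if B x then 0 else a (Suc l) x - a l x)" for m x
  have [measurable]: "z \<in> borel_measurable borel" "\<And>m. a m \<in> measurable borel (count_space UNIV)"
    unfolding z_def a_def by measurable
  have B_iff: "B x \<longleftrightarrow> (\<exists>i j. (f ^^ i) x = (f ^^ j) (z x))" for x
    by (simp add: B_def tail_equiv_def)
  have [measurable]: "Measurable.pred borel B"
    unfolding B_iff[abs_def] by measurable
  have P_iff: "P x s \<longleftrightarrow> \<bar>x\<bar> \<le> real s \<and> (B x \<longrightarrow> (\<exists>i\<in>{..s}. \<exists>j\<in>{..s}. (f ^^ i) x = (f ^^ j) (z x)))
      \<and> (\<not> B x \<longrightarrow> a 0 x \<le> s)" for x s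
    by (auto simp: P_def)
  have [measurable]: "Measurable.pred borel (\<lambda>x. P x s)" for s
    unfolding P_iff by measurable
  note E = equiv_tail_equiv[of f]
  have z_eq: "z x = z y" if "(x, y) \<in> tail_equiv f" for x y
    using orbit_liminf_tail_equiv[OF that] by (simp add: z_def)
  have B_eq: "B x \<longleftrightarrow> B y" if "(x, y) \<in> tail_equiv f" for x y
    using that E z_eq[OF that] unfolding B_def by (metis equivE symD transD)
  have g_tail: "(x, g m x) \<in> tail_equiv f" for m x
  proof (cases "B x")
    case False
    then show ?thesis
      by (intro tail_equivI[of "a m x" f x 0]) (simp add: g_def)
  qed (simp add: g_def B_def)
  have g_eq_tail: "(x, y) \<in> tail_equiv f" if "g m x = g m y" for m x y
    using g_tail[of x m] g_tail[of y m] that E by (metis equivE symD transD)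
  have a_shift: "a m' x = a m x + a m' ((f ^^ a m x) x)" if "m \<le> m'" for m m' x
    unfolding a_def by (rule first_visit_shift) (rule first_visit_mono[OF that])
  have "tail_equiv f = {(x, y). \<exists>m. g m x = g m y}"
  proof (intro equalityI subsetI)
    fix p assume "p \<in> tail_equiv f"
    then obtain x y i j where p: "p = (x, y)" and xy: "(x, y) \<in> tail_equiv f"
      and ij: "(f ^^ i) x = (f ^^ j) y"
      unfolding tail_equiv_def by blast
    \<comment> \<open>Outside \<open>B\<close>, wait until both first visits take place after the orbits have merged.\<close>
    have "\<exists>m. g m x = g m y"
    proof (cases "B x")
      case True
      then show ?thesis using B_eq[OF xy] z_eq[OF xy] by (simp add: g_def)
    next
      case False
      have ne: "(f ^^ l) w \<noteq> orbit_liminf f w" if "\<not> B w" for w l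
        using that tail_equivI[of l f w 0 "z w"] by (auto simp: B_def z_def)
      have nB: "\<not> B y" using False B_eq[OF xy] by simp
      have "\<forall>\<^sub>F m in sequentially. i \<le> a m x \<and> j \<le> a m y"
        unfolding a_def
        by (intro eventually_conj eventually_first_visit_ge ne False nB)
      then obtain m where "i \<le> a m x" "j \<le> a m y"
        by (auto dest: eventually_happens)
      then have "a m x = a m ((f ^^ i) x) + i" "a m y = a m ((f ^^ i) x) + j"
        using first_visit_shift[of i m x] first_visit_shift[of j m y] by (simp_all add: a_def ij)
      then have "(f ^^ a m x) x = (f ^^ a m y) y"
        by (simp add: funpow_add ij)
      then show ?thesis using False nB by (auto simp: g_def)
    qed
    then show "p \<in> {(x, y). \<exists>m. g m x = g m y}" by (simp add: p)
  qed (auto dest: g_eq_tail)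
  moreover have "hyperfinite {(x, y). \<exists>m. g m x = g m y}"
  proof (rule hyperfinite_union_kernels[where c = c])
    fix m
    show "g m \<in> borel_measurable borel"
      unfolding g_def by measurable
    show "c m \<in> measurable borel (count_space UNIV)"
      unfolding c_def by (cases m) simp_all
  next
    fix m x y assume eq: "g m x = g m y"
    note xy = g_eq_tail[OF eq]
    have *: "a (Suc m) x - a m x = a (Suc m) y - a m y \<and>
        (f ^^ a (Suc m) x) x = (f ^^ a (Suc m) y) y" if "\<not> B x"
    proof -
      define u where "u = (f ^^ a m x) x"
      have u': "u = (f ^^ a m y) y"
        using eq that B_eq[OF xy] by (simp add: g_def u_def)
      have "a (Suc m) x = a (Suc m) u + a m x" "a (Suc m) y = a (Suc m) u + a m y"
        using a_shift[of m "Suc m" x] a_shift[of m "Suc m" y] by (simp_all flip: u_def u')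
      then show ?thesis
        by (simp add: funpow_add) (simp flip: u_def u')
    qed
    show "g (Suc m) x = g (Suc m) y" "c (Suc m) x = c (Suc m) y"
      using * B_eq[OF xy] z_eq[OF xy] by (auto simp: g_def c_def)
  next
    fix m k u
    have "\<exists>s. P x s" for x
    proof -
      obtain l where l: "\<bar>x\<bar> \<le> real l" using real_arch_simple by blast
      show ?thesis
      proof (cases "B x")
        case True
        then obtain i j where ij: "(f ^^ i) x = (f ^^ j) (z x)" by (auto simp: B_iff)
        have "\<bar>x\<bar> \<le> real (l + i + j)" "i \<le> l + i + j" "j \<le> l + i + j"
          using l by simp_all
        then have "P x (l + i + j)" using True ij unfolding P_def by (simp only: if_True) blast
        then show ?thesis by blast
      next
        case False
        then have "P x (l + a 0 x)" using l by (simp add: P_def)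
        then show ?thesis by blast
      qed
    qed
    then have "P x (c 0 x)" for x
      unfolding c_def by (auto intro: LeastI_ex)
    moreover have "P x s'" if "P x s" "s \<le> s'" for x s s'
    proof -
      have "real s \<le> real s'" "{..s} \<subseteq> {..s'}" using that(2) by simp_all
      then show ?thesis using that unfolding P_iff by (meson order_trans subsetD)
    qed
    ultimately have P: "P x k" if "c 0 x \<le> k" for x
      using that by blast
    \<comment> \<open>The first visit time telescopes into the initial time and \<open>m\<close> waiting times.\<close>
    have bound: "a m y \<le> k + m * k" if "\<forall>i\<le>m. c i y \<le> k" "\<not> B y" for y
      using that(1)
    proof (induction m)
      case 0
      then show ?case using P[of y] that(2) by (simp add: P_def)
    next
      case (Suc m)
      then have "a (Suc m) y - a m y \<le> k" "a m y \<le> k + m * k"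
        using that(2) by (auto simp: c_def dest: spec[of _ "Suc m"])
      then show ?case by simp
    qed
    have "{y. g m y = u \<and> (\<forall>i\<le>m. c i y \<le> k)} \<subseteq>
        (\<Union>i\<le>k. \<Union>j\<le>k. {y. \<bar>y\<bar> \<le> real k \<and> (f ^^ i) y = (f ^^ j) u}) \<union>
        (\<Union>i\<le>k + m * k. {y. \<bar>y\<bar> \<le> real k \<and> (f ^^ i) y = u})"
    proof
      fix y assume y: "y \<in> {y. g m y = u \<and> (\<forall>i\<le>m. c i y \<le> k)}"
      then have Py: "P y k" using P by simp
      show "y \<in> (\<Union>i\<le>k. \<Union>j\<le>k. {y. \<bar>y\<bar> \<le> real k \<and> (f ^^ i) y = (f ^^ j) u}) \<union>
        (\<Union>i\<le>k + m * k. {y. \<bar>y\<bar> \<le> real k \<and> (f ^^ i) y = u})"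
      proof (cases "B y")
        case True
        then show ?thesis using y Py by (auto simp: P_def g_def)
      next
        case False
        then show ?thesis using y Py bound[of y] by (auto simp: P_def g_def)
      qed
    qed
    then show "finite {y. g m y = u \<and> (\<forall>i\<le>m. c i y \<le> k)}"
      by (rule finite_subset) (auto intro: finite_funpow_fibre[OF bdd fin])
  qed
  ultimately show ?thesis by simp
qed

end


section \<open>The affine action of \<open>BS(1,n)\<close>\<close>

text \<open>
  The exponent \<open>0\<close> is excluded because the identity does not reduce modulo \<open>1\<close>.
\<close>

lemma funpow_frac_mult:
  "((\<lambda>x. frac (real n * x)) ^^ Suc i) x = frac (real n ^ Suc i * x)"
proof (induction i)
  case (Suc i)
  have "frac (real n * frac (real n ^ Suc i * x)) = frac (real n * (real n ^ Suc i * x))"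
    using frac_add_of_int_right[of "real n * (real n ^ Suc i * x)" "- (int n * \<lfloor>real n ^ Suc i * x\<rfloor>)"]
    by (simp add: frac_def[of "real n ^ Suc i * x"] right_diff_distrib del: power_Suc)
  then show ?case using Suc by (simp add: mult.assoc)
qed simp

lemma frac_eq_iff: "frac x = frac y \<longleftrightarrow> x - y \<in> \<int>" for x y :: real
  by (metis Ints_of_int add_diff_cancel_left' diff_add_cancel frac_add_int_right frac_eqE)

lemma tail_equiv_frac_mult:
  "(x, y) \<in> tail_equiv (\<lambda>x. frac (real n * x)) \<longleftrightarrow>
    (\<exists>i j. real n ^ i * x - real n ^ j * y \<in> \<int>)" (is "?L \<longleftrightarrow> ?R")
proof
  let ?f = "\<lambda>x. frac (real n * x)"
  assume ?L
  then obtain i j where "(?f ^^ i) x = (?f ^^ j) y" by (auto simp: tail_equiv_def)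
  then have "(?f ^^ Suc i) x = (?f ^^ Suc j) y" by simp
  then show ?R unfolding funpow_frac_mult frac_eq_iff by blast
next
  assume ?R
  then obtain i j where "real n ^ i * x - real n ^ j * y \<in> \<int>" by blast
  then have "real n * (real n ^ i * x - real n ^ j * y) \<in> \<int>" by (intro Ints_mult) auto
  then have "real n ^ Suc i * x - real n ^ Suc j * y \<in> \<int>"
    by (simp add: right_diff_distrib mult.assoc)
  then show ?L
    by (intro tail_equivI[of "Suc i" _ _ "Suc j"]) (simp only: funpow_frac_mult frac_eq_iff)
qed

lemma finite_frac_mult_fibre:
  assumes "n \<ge> 1"
  shows "finite {x. \<bar>x\<bar> \<le> r \<and> frac (real n * x) = u}"
proof (rule finite_subset)
  show "{x. \<bar>x\<bar> \<le> r \<and> frac (real n * x) = u} \<subseteq>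
      (\<lambda>k. (of_int k + u) / real n) ` {\<lfloor>- (real n * r)\<rfloor>..\<lfloor>real n * r\<rfloor>}"
  proof
    fix x assume "x \<in> {x. \<bar>x\<bar> \<le> r \<and> frac (real n * x) = u}"
    then have x: "- r \<le> x" "x \<le> r" and u: "frac (real n * x) = u" by auto
    have "real n * - r \<le> real n * x" "real n * x \<le> real n * r"
      using x by (intro mult_left_mono; simp)+
    then have "\<lfloor>real n * x\<rfloor> \<in> {\<lfloor>- (real n * r)\<rfloor>..\<lfloor>real n * r\<rfloor>}"
      by (auto intro: floor_mono)
    moreover have "x = (of_int \<lfloor>real n * x\<rfloor> + u) / real n"
      using assms by (simp add: u[symmetric] frac_def)
    ultimately show "x \<in> (\<lambda>k. (of_int k + u) / real n) ` {\<lfloor>- (real n * r)\<rfloor>..\<lfloor>real n * r\<rfloor>}"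
      by blast
  qed
qed simp

lemma orbit_equiv_equiv:
  assumes "group_action G UNIV \<phi>"
  shows "equiv UNIV (orbit_equiv G \<phi>)"
proof -
  interpret group_action G UNIV \<phi> by (rule assms)
  have eq: "orbit_equiv G \<phi> = {(x, y). y \<in> orbit G \<phi> x}"
    by (auto simp: orbit_equiv_def orbit_def)
  show ?thesis
    unfolding eq
    by (rule equivI) (auto simp: refl_on_def orbit_refl intro!: symI transI intro: orbit_sym orbit_trans)
qed

text \<open>
  Every group element is a product of letters. A letter \<open>Inv s\<close> moves \<open>x\<close> to a point that the
  generator \<open>s\<close> moves back to \<open>x\<close>, so symmetry of \<open>E\<close> takes care of it.
\<close>

lemma orbit_equiv_presented_group_subset:
  assumes act: "group_action (presented_group R) UNIV \<phi>"
    and E: "equiv UNIV E"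
    and gen: "\<And>s x. (x, \<phi> (pres_class R [Gen s]) x) \<in> E"
  shows "orbit_equiv (presented_group R) \<phi> \<subseteq> E"
proof -
  let ?G = "presented_group R"
  interpret group_action ?G UNIV \<phi> by (rule act)
  have carrier: "pres_class R w \<in> carrier ?G" for w
    by (simp add: presented_group_def)
  have append: "\<phi> (pres_class R (u @ v)) x = \<phi> (pres_class R u) (\<phi> (pres_class R v) x)" for u v x
    using composition_rule[of x "pres_class R u" "pres_class R v"] carrier
    by (simp add: mult_pres_class)
  have empty: "\<phi> (pres_class R []) x = x" for x
    using fun_cong[OF id_eq_one, of x] by (simp add: presented_group_def)
  have letter: "(x, \<phi> (pres_class R [l]) x) \<in> E" for l x
  proof (cases l)
    case (Inv s)
    have "pres_class R ([Gen s] @ [Inv s]) = pres_class R []"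
      unfolding pres_class_eq_iff using pres_eq.cancel[of R "[]" "Gen s" "[]"] by simp
    then have "\<phi> (pres_class R [Gen s]) (\<phi> (pres_class R [Inv s]) x) = x"
      using append[of "[Gen s]" "[Inv s]" x] by (simp add: empty)
    then show ?thesis
      using gen[of "\<phi> (pres_class R [Inv s]) x" s] E Inv by (metis equivE symD)
  qed (simp add: gen)
  have "(x, \<phi> (pres_class R w) x) \<in> E" for w x
  proof (induction w)
    case Nil
    show ?case using E by (simp add: empty equiv_class_eq_iff)
  next
    case (Cons l w)
    then show ?case
      using letter[of "\<phi> (pres_class R w) x" l] append[of "[l]" w x] E by (metis append_Cons append_Nil equivE transD)
  qed
  then show ?thesis
    by (auto simp: orbit_equiv_def presented_group_def)
qed

text \<open>
  For the inclusion from right to left, \<open>x\<close> is connected to \<open>n\<^sup>i x\<close> by \<open>b\<^sup>-\<^sup>i\<close>, this to \<open>n\<^sup>j y\<close>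
  by an integer translation, and the latter to \<open>y\<close> by \<open>b\<^sup>j\<close>.
\<close>

lemma orbit_equiv_BS1:
  assumes n: "n \<ge> 1" and act: "BS1_affine_action n \<phi>"
  shows "orbit_equiv (BS1 n) \<phi> = tail_equiv (\<lambda>x. frac (real n * x))"
    (is "?O = ?T")
proof
  have ga: "group_action (BS1 n) UNIV \<phi>"
    and a: "\<phi> (BS1_a n) = (\<lambda>x. x + 1)" and b: "\<phi> (BS1_b n) = (\<lambda>x. x / real n)"
    using act by (auto simp: BS1_affine_action_def)
  have "(x, \<phi> (pres_class (BS1_relations n) [Gen s]) x) \<in> ?T" for s x
  proof (cases s)
    case gen_a
    have "real n ^ 0 * x - real n ^ 0 * (x + 1) \<in> \<int>" by simp
    then show ?thesis
      using a unfolding tail_equiv_frac_mult gen_a BS1_a_def by metis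
  next
    case gen_b
    have "real n ^ 0 * x - real n ^ 1 * (x / real n) \<in> \<int>" using n by simp
    then show ?thesis
      using b unfolding tail_equiv_frac_mult gen_b BS1_b_def by metis
  qed
  then show "?O \<subseteq> ?T"
    using ga unfolding BS1_def
    by (intro orbit_equiv_presented_group_subset equiv_tail_equiv)
  have O: "equiv UNIV ?O" by (rule orbit_equiv_equiv[OF ga])
  have refl: "(x, x) \<in> ?O" for x using O by (simp add: equiv_class_eq_iff)
  have sym: "(y, x) \<in> ?O" if "(x, y) \<in> ?O" for x y using O that by (metis equivE symD)
  have trans [trans]: "(x, z) \<in> ?O" if "(x, y) \<in> ?O" "(y, z) \<in> ?O" for x y z
    using O that by (metis equivE transD)
  have add: "(x, x + 1) \<in> ?O" and div: "(x, x / real n) \<in> ?O" for x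
    using fun_cong[OF a, of x] fun_cong[OF b, of x]
    by (auto simp: orbit_equiv_def BS1_def BS1_a_def BS1_b_def presented_group_def intro: exI[of _ "[_]"])
  have power: "(x, real n ^ i * x) \<in> ?O" for i x
  proof (induction i)
    case (Suc i)
    have "(real n ^ i * x, real n ^ Suc i * x) \<in> ?O"
      using sym[OF div[of "real n ^ Suc i * x"]] n by simp
    with Suc show ?case by (rule trans)
  qed (simp add: refl)
  have nat: "(x, x + real k) \<in> ?O" for k x
  proof (induction k)
    case (Suc k)
    then show ?case
      using trans[OF Suc add[of "x + real k"]] by (simp add: add_ac)
  qed (simp add: refl)
  show "?T \<subseteq> ?O"
  proof
    fix p assume "p \<in> ?T"
    then obtain x y i j where p: "p = (x, y)" and "real n ^ i * x - real n ^ j * y \<in> \<int>"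
      by (cases p) (auto simp: tail_equiv_frac_mult)
    then obtain k where k: "real n ^ i * x - real n ^ j * y = of_int k" by (auto elim: Ints_cases)
    have "(real n ^ i * x, real n ^ j * y) \<in> ?O"
    proof (cases "k \<ge> 0")
      case True
      then have "real n ^ i * x = real n ^ j * y + real (nat k)" using k by simp
      then show ?thesis using sym[OF nat[of "real n ^ j * y" "nat k"]] by simp
    next
      case False
      then have "real n ^ j * y = real n ^ i * x + real (nat (- k))" using k by simp
      then show ?thesis using nat[of "real n ^ i * x" "nat (- k)"] by simp
    qed
    then show "p \<in> ?O"
      unfolding p using power[of x i] sym[OF power[of y j]] trans by blast
  qed
qed

theorem mainTheorem1:
  fixes n :: nat and \<phi> :: "bs_gen word set \<Rightarrow> real \<Rightarrow> real"
  assumes "n \<ge> 2"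
    and "BS1_affine_action n \<phi>"
  shows "hyperfinite (orbit_equiv (BS1 n) \<phi>)"
proof -
  let ?f = "\<lambda>x. frac (real n * x)"
  have "hyperfinite (tail_equiv ?f)"
  proof (rule hyperfinite_tail_equiv)
    show "bounded (range ?f)"
      by (rule boundedI[of _ 1]) (auto simp: abs_le_iff less_imp_le[OF frac_lt_1] intro: order_trans[of _ 0])
    show "?f \<in> borel_measurable borel"
      unfolding frac_def by measurable
    show "finite {x. \<bar>x\<bar> \<le> r \<and> ?f x = u}" for r u
      using finite_frac_mult_fibre assms(1) by simp
  qed
  then show ?thesis
    using orbit_equiv_BS1[of n \<phi>] assms by simp
qed

end
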